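(* Let $\Omega\subseteq\mathbb{R}^d$ be nonempty, closed and convex, and let $U:\Omega\to\Omega$ be paramonotone and continuous on $\Omega$ with $\mathrm{Sol}(U,\Omega)\neq\emptyset$. Let $\xi,\beta_1,\beta_0$ be sequences with values in $[0,\infty)$ and $\eta$ a sequence of real numbers, and assume: (1) there exist constants $Q_2\in(0,1)$ and $Q_1>0$ such that $[\beta_1(n)-1+\xi(n)]\,[\beta_1(n)-1+(\eta(n)^2+Q_1)\xi(n)]\le 1-Q_2$ for all integers $n\ge 0$; (2) $-1\le\eta(n)\le 0$ for all integers $n\ge 0$; (3) the sequence $\beta_1(n)-\xi(n)\eta(n)$, $n\ge 0$, is decreasing (nonincreasing); (4) $\sum_{j=0}^\infty\xi(j)\beta_0(j)^2<\infty$; (5) $\sum_{j=0}^\infty\xi(j)\beta_0(j)=\infty$; (6) $1\le\beta_1(n)\le\beta_1(n)+\xi(n)\le 2$ for all integers $n\ge 0$. Let $z(0),z(1)\in\Omega$ and let $(z(n))_{n\ge 0}$ satisfy, for all $n\ge 1$, $$z^{\Delta\nabla}(n)+\beta_1(n)z^\nabla(n)=\xi(n)[w(n)-z(n)],$$ $$w(n)=P_\Omega\left(z(n)+\eta(n)z^\nabla(n)-\frac{\beta_0(n)}{\max\{1,\|U(z(n)+\eta(n)z^\nabla(n))\|\}}\,U(z(n)+\eta(n)z^\nabla(n))\right).$$ Then there is $z_\star\in\mathrm{Sol}(U,\Omega)$ such that $\lim_{n\to\infty}z(n)=z_\star$.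
   Context: $\langle\cdot,\cdot\rangle$ and $\|\cdot\|$ are the Euclidean inner product and norm on $\mathbb{R}^d$, and $P_\Omega$ is the metric projection onto $\Omega$. $\mathrm{Sol}(U,\Omega)$ is the set of $x_\star\in\Omega$ with $\langle U(x_\star),a-x_\star\rangle\ge 0$ for all $a\in\Omega$. $U$ is monotone if $\langle U(a)-U(b),a-b\rangle\ge 0$ for all $a,b\in\Omega$; $U$ is paramonotone if it is monotone and, for all $a,b\in\Omega$, $\langle U(a)-U(b),a-b\rangle=0$ if and only if $U(a)=U(b)$. $z^\nabla(n)=z(n)-z(n-1)$ and $z^{\Delta\nabla}(n)=z(n+1)-2z(n)+z(n-1)$. Since $U$ is defined only on $\Omega$, the formula for $w(n)$ is understood with $z(n)+\eta(n)z^\nabla(n)\in\Omega$. *)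

theory Defs
  imports "HOL-Analysis.Analysis"
begin

definition vi_solutions :: "('a::real_inner \<Rightarrow> 'a) \<Rightarrow> 'a set \<Rightarrow> 'a set" where
  "vi_solutions U \<Omega> = {x \<in> \<Omega>. \<forall>a\<in>\<Omega>. U x \<bullet> (a - x) \<ge> 0}"

definition monotone_operator_on :: "'a::real_inner set \<Rightarrow> ('a \<Rightarrow> 'a) \<Rightarrow> bool" where
  "monotone_operator_on \<Omega> U \<longleftrightarrow> (\<forall>a\<in>\<Omega>. \<forall>b\<in>\<Omega>. (U a - U b) \<bullet> (a - b) \<ge> 0)"

definition paramonotone_on :: "'a::real_inner set \<Rightarrow> ('a \<Rightarrow> 'a) \<Rightarrow> bool" where
  "paramonotone_on \<Omega> U \<longleftrightarrow> monotone_operator_on \<Omega> U \<and>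
     (\<forall>a\<in>\<Omega>. \<forall>b\<in>\<Omega>. (U a - U b) \<bullet> (a - b) = 0 \<longleftrightarrow> U a = U b)"

text \<open>The two difference operators below are meaningful only for \<open>n \<ge> 1\<close>: at \<open>n = 0\<close> the
  truncated subtraction \<open>n - 1\<close> gives junk values.\<close>

definition backward_diff :: "(nat \<Rightarrow> 'a::real_vector) \<Rightarrow> nat \<Rightarrow> 'a" where
  "backward_diff z n = z n - z (n - 1)"

definition second_diff :: "(nat \<Rightarrow> 'a::real_vector) \<Rightarrow> nat \<Rightarrow> 'a" where
  "second_diff z n = z (n + 1) - 2 *\<^sub>R z n + z (n - 1)"

end

theory Submission
  imports Defs
begin

text \<open>Put \<open>\<gamma> = \<beta>\<^sub>1 - 1\<close>, \<open>y n = z n + \<eta> n (z n - z (n - 1))\<close> and \<open>\<delta> = \<gamma> - \<xi> \<eta>\<close>. Since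
  \<open>z (n + 1)\<close> is a convex combination of \<open>z n\<close>, \<open>z (n - 1)\<close>, \<open>w n\<close>, and \<open>y n\<close> one of \<open>z n\<close>,
  \<open>z (n - 1)\<close>, the function \<open>V n = \<parallel>z n - p\<parallel>\<^sup>2 + \<delta> n \<parallel>z (n - 1) - p\<parallel>\<^sup>2\<close> is, for every solution \<open>p\<close>,
  nonincreasing up to the summable error \<open>2 \<xi> \<beta>\<^sub>0\<^sup>2\<close>. Its decrease makes \<open>\<xi> \<parallel>w - y\<parallel>\<^sup>2\<close> summable,
  which by condition (1) forces \<open>\<Sum> \<parallel>z n - z (n - 1)\<parallel>\<^sup>2 < \<infinity>\<close>, so that \<open>\<parallel>z n - p\<parallel>\<close> converges. The
  decrease also makes \<open>\<xi> \<beta>\<^sub>0 \<langle>U (y n), y n - p\<rangle>\<close> summable, so \<open>\<langle>U (y n), y n - p\<rangle>\<close> tends to \<open>0\<close> along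
  some indices; by paramonotonicity a cluster point of \<open>y\<close> along them is a solution, and it is the
  limit of \<open>z\<close>.\<close>

text \<open>Telescoping the step bounds the partial sums of \<open>s\<close> by
  \<open>V 0 + suminf e\<close>. Subtracting the partial sums of \<open>e\<close> from
  \<open>V\<close> leaves a nonincreasing sequence bounded below by
  \<open>- suminf e\<close>.\<close>

lemma quasi_decreasing_convergent:
  fixes V s e :: "nat \<Rightarrow> real"
  assumes V: "\<And>n. 0 \<le> V n" and s: "\<And>n. 0 \<le> s n" and e: "\<And>n. 0 \<le> e n"
    and sum_e: "summable e"
    and step: "\<And>n. V (Suc n) \<le> V n + e n - s n"
  shows "convergent V" and "summable s"
proof -
  have tel: "V n + (\<Sum>k<n. s k) \<le> V 0 + (\<Sum>k<n. e k)" for n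
  proof (induction n)
    case (Suc n)
    then show ?case using step[of n] by simp
  qed simp
  have le_suminf: "(\<Sum>k<n. e k) \<le> suminf e" for n
    using sum_e e by (intro sum_le_suminf) auto
  show "summable s"
  proof (rule bounded_imp_summable[OF s])
    show "(\<Sum>k\<le>n. s k) \<le> V 0 + suminf e" for n
      using tel[of "Suc n"] le_suminf[of "Suc n"] V[of "Suc n"] by (simp add: lessThan_Suc_atMost)
  qed
  define W where "W n = V n - (\<Sum>k<n. e k)" for n
  have "decseq W"
  proof (rule decseq_SucI)
    show "W (Suc n) \<le> W n" for n
      using step[of n] s[of n] by (simp add: W_def)
  qed
  moreover have "- suminf e \<le> W n" for n
    using V[of n] le_suminf[of n] by (simp add: W_def)
  ultimately obtain L where "W \<longlonglongrightarrow> L"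
    using decseq_convergent by metis
  moreover have "(\<lambda>n. \<Sum>k<n. e k) \<longlonglongrightarrow> suminf e"
    using sum_e by (rule summable_LIMSEQ)
  ultimately have "(\<lambda>n. W n + (\<Sum>k<n. e k)) \<longlonglongrightarrow> L + suminf e"
    by (rule tendsto_add)
  then show "convergent V"
    by (auto simp: W_def convergent_def)
qed

text \<open>As \<open>q * x n = x n - (1 - q) * x n\<close>, the sequence \<open>x\<close> is its
  own Lyapunov function, and the decrease \<open>(1 - q) * x n\<close> is what gets summed.\<close>

lemma summable_contraction:
  fixes x b :: "nat \<Rightarrow> real"
  assumes "\<And>n. 0 \<le> x n" and "\<And>n. 0 \<le> b n" and "summable b" and "q < 1"
    and "\<And>n. x (Suc n) \<le> q * x n + b n"
  shows "summable x"
proof -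
  have "summable (\<lambda>n. (1 - q) * x n)"
  proof (rule quasi_decreasing_convergent(2)[OF assms(1) _ assms(2,3)])
    show "0 \<le> (1 - q) * x n" for n
      using assms(1)[of n] assms(4) by simp
    show "x (Suc n) \<le> x n + b n - (1 - q) * x n" for n
      using assms(5)[of n] by (simp add: algebra_simps)
  qed
  then show ?thesis
    using assms(4) by simp
qed

text \<open>Otherwise \<open>c n * e\<close> is dominated by \<open>c n * t n\<close> from
  \<open>N\<close> on. This is how the divergence of the series of
  \<open>\<xi> j * \<beta>\<^sub>0 j\<close> enters.\<close>

lemma summable_mult_nonsummable_imp_small:
  fixes c t :: "nat \<Rightarrow> real"
  assumes c: "\<And>n. 0 \<le> c n" and "\<not> summable c" and sum_ct: "summable (\<lambda>n. c n * t n)" and "0 < e"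
  shows "\<exists>n\<ge>N. t n < e"
proof (rule ccontr)
  assume "\<not> (\<exists>n\<ge>N. t n < e)"
  then have t: "e \<le> t n" if "n \<ge> N" for n
    using that by force
  have "summable (\<lambda>n. c n * e)"
  proof (rule summable_comparison_test'[OF sum_ct])
    show "norm (c n * e) \<le> c n * t n" if "n \<ge> N" for n
      using t[OF that] c[of n] \<open>0 < e\<close> by (simp add: mult_left_mono)
  qed
  then have "summable (\<lambda>n. c n * e / e)"
    by (rule summable_divide)
  then show False
    using assms(2,4) by simp
qed

text \<open>Convexity of the squared norm in exact form: the gap between the sides is a weighted sum
  of squared pairwise distances.\<close>

lemma norm_convex_combination3_le:
  fixes u v w :: "'a::real_inner"
  assumes "0 \<le> a" "0 \<le> b" "0 \<le> c" "a + b + c = 1"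
  shows "(norm (a *\<^sub>R u + b *\<^sub>R v + c *\<^sub>R w))\<^sup>2 \<le> a * (norm u)\<^sup>2 + b * (norm v)\<^sup>2 + c * (norm w)\<^sup>2"
proof -
  have a: "a = 1 - b - c" using assms(4) by simp
  have "a * (norm u)\<^sup>2 + b * (norm v)\<^sup>2 + c * (norm w)\<^sup>2 - (norm (a *\<^sub>R u + b *\<^sub>R v + c *\<^sub>R w))\<^sup>2
      = a * b * (norm (u - v))\<^sup>2 + b * c * (norm (v - w))\<^sup>2 + a * c * (norm (u - w))\<^sup>2"
    unfolding power2_norm_eq_inner a
    by (simp add: inner_simps inner_commute[of v u] inner_commute[of w u] inner_commute[of w v] algebra_simps)
  also have "\<dots> \<ge> 0" using assms by simp
  finally show ?thesis by simp
qed

text \<open>The weights need not sum to 1. The factor \<open>a + b\<close> becomes the first factor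
  of the product that is assumed to be at most \<open>1 - Q\<^sub>2\<close>.\<close>

lemma norm_diff_scaleR_le:
  fixes u v :: "'a::real_inner"
  assumes "0 \<le> a" "0 \<le> b"
  shows "(norm (b *\<^sub>R v - a *\<^sub>R u))\<^sup>2 \<le> (a + b) * (a * (norm u)\<^sup>2 + b * (norm v)\<^sup>2)"
proof -
  have "(a + b) * (a * (norm u)\<^sup>2 + b * (norm v)\<^sup>2) - (norm (b *\<^sub>R v - a *\<^sub>R u))\<^sup>2
      = a * b * (norm (u + v))\<^sup>2"
    unfolding power2_norm_eq_inner
    by (simp add: inner_simps inner_commute[of v u] algebra_simps)
  also have "\<dots> \<ge> 0" using assms by simp
  finally show ?thesis by simp
qed

text \<open>Young's inequality for the cross term. Its free parameter \<open>Q\<close> is placed so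
  that \<open>\<eta>\<^sup>2 + Q\<close> matches the hypothesis on \<open>Q\<^sub>1\<close>.\<close>

lemma norm_add_weighted_le:
  fixes u v :: "'a::real_inner"
  assumes "0 < Q"
  shows "(norm (\<eta> *\<^sub>R u + v))\<^sup>2 \<le> (\<eta>\<^sup>2 + Q) * (norm u)\<^sup>2 + (1 + \<eta>\<^sup>2 / Q) * (norm v)\<^sup>2"
proof -
  have "0 \<le> (norm (Q *\<^sub>R u - \<eta> *\<^sub>R v))\<^sup>2 / Q"
    using assms by simp
  also have "\<dots> = Q * (u \<bullet> u) - 2 * \<eta> * (u \<bullet> v) + \<eta>\<^sup>2 / Q * (v \<bullet> v)"
    unfolding power2_norm_eq_inner using assms
    by (simp add: inner_simps inner_commute[of v u] field_simps power2_eq_square)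
  finally show ?thesis
    unfolding power2_norm_eq_inner
    by (simp add: inner_simps inner_commute[of v u] algebra_simps power2_eq_square)
qed

text \<open>The obtuse angle property of the projection gives a full
  \<open>- (norm (w - y))\<^sup>2\<close> and the cross term
  \<open>- 2 * (g \<bullet> (w - y))\<close>. Half of the former absorbs the latter at the cost of
  \<open>2 * (norm g)\<^sup>2\<close>; the other half is kept to control the increments.\<close>

lemma closest_point_shifted_le:
  fixes y g p :: "'a::euclidean_space"
  assumes "convex S" "closed S" "p \<in> S"
  defines "w \<equiv> closest_point S (y - g)"
  shows "(norm (w - p))\<^sup>2 \<le> (norm (y - p))\<^sup>2 - 2 * (g \<bullet> (y - p)) + 2 * (norm g)\<^sup>2 - (norm (w - y))\<^sup>2 / 2"
proof -
  have "(y - g - w) \<bullet> (p - w) \<le> 0"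
    unfolding w_def by (rule closest_point_dot[OF assms(1-3)])
  moreover have "0 \<le> (norm (2 *\<^sub>R g + (w - y)))\<^sup>2" by simp
  ultimately show ?thesis
    unfolding power2_norm_eq_inner
    by (simp add: inner_simps inner_commute algebra_simps add_divide_distrib diff_divide_distrib)
qed

text \<open>Here \<open>u\<close>, \<open>v\<close>, \<open>w\<close> stand for \<open>z n\<close>,
  \<open>z (n - 1)\<close>, \<open>w n\<close>. The new iterate is their convex combination with
  weights \<open>1 - \<gamma> - \<xi>\<close>, \<open>\<gamma>\<close>, \<open>\<xi>\<close>.
  Splitting the share of \<open>w\<close> by the weights \<open>1 + \<eta>\<close>,
  \<open>- \<eta>\<close> of the extrapolated point yields the total weight
  \<open>\<gamma> - \<xi> * \<eta>\<close> on \<open>v\<close>.\<close>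

lemma relaxed_step_dist_le:
  fixes u v w p :: "'a::real_inner"
  assumes "0 \<le> \<gamma>" "0 \<le> \<xi>" "\<gamma> + \<xi> \<le> 1" "-1 \<le> \<eta>" "\<eta> \<le> 0"
    and w: "(norm (w - p))\<^sup>2 \<le> (norm (u + \<eta> *\<^sub>R (u - v) - p))\<^sup>2 + r"
  shows "(norm (u + \<xi> *\<^sub>R (w - u) - \<gamma> *\<^sub>R (u - v) - p))\<^sup>2
    \<le> (1 - (\<gamma> - \<xi> * \<eta>)) * (norm (u - p))\<^sup>2 + (\<gamma> - \<xi> * \<eta>) * (norm (v - p))\<^sup>2 + \<xi> * r"
proof -
  \<comment> \<open>A null third term lets the three-point inequality serve for two points.\<close>
  have "u + \<eta> *\<^sub>R (u - v) - p = (1 + \<eta>) *\<^sub>R (u - p) + (- \<eta>) *\<^sub>R (v - p) + 0 *\<^sub>R 0"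
    by (simp add: algebra_simps)
  then have y: "(norm (u + \<eta> *\<^sub>R (u - v) - p))\<^sup>2 \<le> (1 + \<eta>) * (norm (u - p))\<^sup>2 - \<eta> * (norm (v - p))\<^sup>2"
    using norm_convex_combination3_le[of "1 + \<eta>" "- \<eta>" 0 "u - p" "v - p" 0] assms by simp
  have "u + \<xi> *\<^sub>R (w - u) - \<gamma> *\<^sub>R (u - v) - p
      = (1 - \<gamma> - \<xi>) *\<^sub>R (u - p) + \<gamma> *\<^sub>R (v - p) + \<xi> *\<^sub>R (w - p)"
    by (simp add: algebra_simps)
  then have "(norm (u + \<xi> *\<^sub>R (w - u) - \<gamma> *\<^sub>R (u - v) - p))\<^sup>2
      \<le> (1 - \<gamma> - \<xi>) * (norm (u - p))\<^sup>2 + \<gamma> * (norm (v - p))\<^sup>2 + \<xi> * (norm (w - p))\<^sup>2"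
    using norm_convex_combination3_le[of "1 - \<gamma> - \<xi>" \<gamma> \<xi> "u - p" "v - p" "w - p"] assms by simp
  also have "\<xi> * (norm (w - p))\<^sup>2
      \<le> \<xi> * ((1 + \<eta>) * (norm (u - p))\<^sup>2 - \<eta> * (norm (v - p))\<^sup>2 + r)"
    using w y assms(2) by (intro mult_left_mono) auto
  finally show ?thesis by (simp add: algebra_simps)
qed

text \<open>Write \<open>w - u\<close> as \<open>\<eta> *\<^sub>R (u - v)\<close> plus the distance
  vector from the extrapolated point to \<open>w\<close>, and apply Young. The bound
  \<open>\<eta>\<^sup>2 \<le> 1\<close> makes the last constant independent of \<eta>.\<close>

lemma relaxed_step_increment_le:
  fixes u v w :: "'a::real_inner"
  assumes "0 \<le> \<gamma>" "0 \<le> \<xi>" "\<gamma> + \<xi> \<le> 1" "-1 \<le> \<eta>" "\<eta> \<le> 0" "0 < Q"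
  shows "(norm (\<xi> *\<^sub>R (w - u) - \<gamma> *\<^sub>R (u - v)))\<^sup>2
    \<le> (\<gamma> + \<xi>) * (\<gamma> + (\<eta>\<^sup>2 + Q) * \<xi>) * (norm (u - v))\<^sup>2
      + (1 + 1 / Q) * (\<xi> * (norm (w - (u + \<eta> *\<^sub>R (u - v))))\<^sup>2)"
proof -
  define E where "E = (norm (w - (u + \<eta> *\<^sub>R (u - v))))\<^sup>2"
  define D where "D = (norm (u - v))\<^sup>2"
  have "E \<ge> 0" by (simp add: E_def)
  have "\<eta>\<^sup>2 \<le> 1"
    using assms(4,5) by (simp add: abs_square_le_1)
  then have "\<eta>\<^sup>2 / Q \<le> 1 / Q"
    using assms(6) by (simp add: divide_right_mono)
  then have "(1 + \<eta>\<^sup>2 / Q) * E \<le> (1 + 1 / Q) * E"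
    using \<open>E \<ge> 0\<close> by (intro mult_right_mono) auto
  moreover have "w - u = \<eta> *\<^sub>R (u - v) + (w - (u + \<eta> *\<^sub>R (u - v)))"
    by simp
  then have "(norm (w - u))\<^sup>2 \<le> (\<eta>\<^sup>2 + Q) * D + (1 + \<eta>\<^sup>2 / Q) * E"
    unfolding E_def D_def by (metis norm_add_weighted_le[OF assms(6)])
  ultimately have wu: "(norm (w - u))\<^sup>2 \<le> (\<eta>\<^sup>2 + Q) * D + (1 + 1 / Q) * E"
    by simp
  have "(norm (\<xi> *\<^sub>R (w - u) - \<gamma> *\<^sub>R (u - v)))\<^sup>2 \<le> (\<gamma> + \<xi>) * (\<gamma> * D + \<xi> * (norm (w - u))\<^sup>2)"
    unfolding D_def using assms(1,2) by (rule norm_diff_scaleR_le)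
  also have "\<dots> \<le> (\<gamma> + \<xi>) * (\<gamma> * D + \<xi> * ((\<eta>\<^sup>2 + Q) * D + (1 + 1 / Q) * E))"
    using assms wu by (intro mult_left_mono add_left_mono) auto
  also have "\<dots> = (\<gamma> + \<xi>) * (\<gamma> + (\<eta>\<^sup>2 + Q) * \<xi>) * D + (\<gamma> + \<xi>) * ((1 + 1 / Q) * (\<xi> * E))"
    by (simp add: algebra_simps)
  also have "(\<gamma> + \<xi>) * ((1 + 1 / Q) * (\<xi> * E)) \<le> (1 + 1 / Q) * (\<xi> * E)"
    using assms \<open>E \<ge> 0\<close> by (intro mult_left_le_one_le) auto
  finally show ?thesis by (simp add: E_def D_def)
qed

lemma vi_solution_inner_nonneg:
  assumes "monotone_operator_on S U" "p \<in> vi_solutions U S" "y \<in> S"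
  shows "0 \<le> U y \<bullet> (y - p)"
proof -
  have "0 \<le> (U y - U p) \<bullet> (y - p)" "0 \<le> U p \<bullet> (y - p)"
    using assms by (auto simp: monotone_operator_on_def vi_solutions_def)
  then show ?thesis by (simp add: inner_diff_left)
qed

text \<open>The value \<open>(U x - U p) \<bullet> (x - p)\<close> equals
  \<open>- (U p \<bullet> (x - p)) \<le> 0\<close>, so monotonicity makes it vanish and
  \<open>U x = U p\<close>. Then \<open>U x \<bullet> (a - x)\<close> equals
  \<open>U p \<bullet> (a - p)\<close>.\<close>

lemma paramonotone_vi_solutionI:
  assumes "paramonotone_on S U" "p \<in> vi_solutions U S" "x \<in> S" "U x \<bullet> (x - p) = 0"
  shows "x \<in> vi_solutions U S"
proof -
  have p: "p \<in> S" "0 \<le> U p \<bullet> (a - p)" if "a \<in> S" for a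
    using assms(2) that by (auto simp: vi_solutions_def)
  have "0 \<le> (U x - U p) \<bullet> (x - p)"
    using assms(1,3) p[OF assms(3)] by (auto simp: paramonotone_on_def monotone_operator_on_def)
  with p[OF assms(3)] assms(4) have "(U x - U p) \<bullet> (x - p) = 0"
    by (simp add: inner_diff_left)
  then have eq: "U x = U p"
    using assms(1,3) p[OF assms(3)] by (auto simp: paramonotone_on_def)
  have "0 \<le> U x \<bullet> (a - x)" if "a \<in> S" for a
    using p(2)[OF that] assms(4) by (simp add: eq inner_diff_right)
  then show ?thesis
    using assms(3) by (simp add: vi_solutions_def)
qed

theorem theorem4p3:
  fixes \<Omega> :: "(real ^ 'd) set"
    and U :: "real ^ 'd \<Rightarrow> real ^ 'd"
    and \<xi> \<beta>\<^sub>1 \<beta>\<^sub>0 \<eta> :: "nat \<Rightarrow> real"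
    and z w :: "nat \<Rightarrow> real ^ 'd"
  assumes "\<Omega> \<noteq> {}" and "closed \<Omega>" and "convex \<Omega>"
    and "U \<in> \<Omega> \<rightarrow> \<Omega>"
    and "paramonotone_on \<Omega> U"
    and "continuous_on \<Omega> U"
    and "vi_solutions U \<Omega> \<noteq> {}"
    and "\<And>n. \<xi> n \<ge> 0" and "\<And>n. \<beta>\<^sub>1 n \<ge> 0" and "\<And>n. \<beta>\<^sub>0 n \<ge> 0"
    and "\<exists>Q\<^sub>2 Q\<^sub>1. 0 < Q\<^sub>2 \<and> Q\<^sub>2 < 1 \<and> 0 < Q\<^sub>1 \<and>
           (\<forall>n. (\<beta>\<^sub>1 n - 1 + \<xi> n) * (\<beta>\<^sub>1 n - 1 + ((\<eta> n)\<^sup>2 + Q\<^sub>1) * \<xi> n) \<le> 1 - Q\<^sub>2)"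
    and "\<And>n. -1 \<le> \<eta> n \<and> \<eta> n \<le> 0"
    and "decseq (\<lambda>n. \<beta>\<^sub>1 n - \<xi> n * \<eta> n)"
    and "summable (\<lambda>j. \<xi> j * (\<beta>\<^sub>0 j)\<^sup>2)"
    and "filterlim (\<lambda>n. \<Sum>j<n. \<xi> j * \<beta>\<^sub>0 j) at_top sequentially"
    and "\<And>n. 1 \<le> \<beta>\<^sub>1 n \<and> \<beta>\<^sub>1 n \<le> \<beta>\<^sub>1 n + \<xi> n \<and> \<beta>\<^sub>1 n + \<xi> n \<le> 2"
    and "z 0 \<in> \<Omega>" and "z 1 \<in> \<Omega>"
    and "\<And>n. n \<ge> 1 \<Longrightarrow> z n + \<eta> n *\<^sub>R backward_diff z n \<in> \<Omega>"
    and "\<And>n. n \<ge> 1 \<Longrightarrow>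
           second_diff z n + \<beta>\<^sub>1 n *\<^sub>R backward_diff z n = \<xi> n *\<^sub>R (w n - z n)"
    and "\<And>n. n \<ge> 1 \<Longrightarrow>
           w n = closest_point \<Omega>
             (z n + \<eta> n *\<^sub>R backward_diff z n
              - (\<beta>\<^sub>0 n / max 1 (norm (U (z n + \<eta> n *\<^sub>R backward_diff z n))))
                *\<^sub>R U (z n + \<eta> n *\<^sub>R backward_diff z n))"
  shows "\<exists>z\<^sub>s \<in> vi_solutions U \<Omega>. z \<longlonglongrightarrow> z\<^sub>s"
proof -

  \<comment> \<open>Notation and the recursion, shifted to \<open>Suc n\<close>\<close>
  note cl = \<open>closed \<Omega>\<close> and cvx = \<open>convex \<Omega>\<close> and pm = \<open>paramonotone_on \<Omega> U\<close>
    and cont = \<open>continuous_on \<Omega> U\<close>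
    and \<xi> = \<open>\<And>n. \<xi> n \<ge> 0\<close> and \<beta>\<^sub>0 = \<open>\<And>n. \<beta>\<^sub>0 n \<ge> 0\<close>
    and \<eta> = \<open>\<And>n. -1 \<le> \<eta> n \<and> \<eta> n \<le> 0\<close>
    and \<beta>\<^sub>1 = \<open>\<And>n. 1 \<le> \<beta>\<^sub>1 n \<and> \<beta>\<^sub>1 n \<le> \<beta>\<^sub>1 n + \<xi> n \<and> \<beta>\<^sub>1 n + \<xi> n \<le> 2\<close>
  have mono: "monotone_operator_on \<Omega> U"
    using pm by (simp add: paramonotone_on_def)
  obtain Q\<^sub>2 Q\<^sub>1 where Q: "0 < Q\<^sub>2" "0 < Q\<^sub>1"
    "\<And>n. (\<beta>\<^sub>1 n - 1 + \<xi> n) * (\<beta>\<^sub>1 n - 1 + ((\<eta> n)\<^sup>2 + Q\<^sub>1) * \<xi> n) \<le> 1 - Q\<^sub>2"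
    using assms(11) by blast
  \<comment> \<open>This is the weight of \<open>z (n - 1)\<close> in the distance estimate. It
    differs by 1 from the sequence assumed nonincreasing.\<close>
  define \<delta> where "\<delta> n = \<beta>\<^sub>1 n - 1 - \<xi> n * \<eta> n" for n
  define y where "y n = z n + \<eta> n *\<^sub>R (z n - z (n - 1))" for n
  define g where "g n = (\<beta>\<^sub>0 n / max 1 (norm (U (y n)))) *\<^sub>R U (y n)" for n
  have y_mem: "y (Suc n) \<in> \<Omega>" for n
    using assms(19)[of "Suc n"] by (simp add: y_def backward_diff_def)
  have w_eq: "w (Suc n) = closest_point \<Omega> (y (Suc n) - g (Suc n))" for n
    using assms(21)[of "Suc n"] by (simp add: y_def g_def backward_diff_def)
  have z_eq: "z (Suc (Suc n)) = z (Suc n) + \<xi> (Suc n) *\<^sub>R (w (Suc n) - z (Suc n))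
      - (\<beta>\<^sub>1 (Suc n) - 1) *\<^sub>R (z (Suc n) - z n)" for n
    using assms(20)[of "Suc n"]
    by (simp add: second_diff_def backward_diff_def algebra_simps scaleR_2)
  have \<delta>0: "0 \<le> \<delta> n" for n
    using \<xi>[of n] \<eta>[of n] \<beta>\<^sub>1[of n] mult_nonneg_nonpos[of "\<xi> n" "\<eta> n"]
    by (simp add: \<delta>_def)
  have dec: "decseq \<delta>"
    using assms(13) by (auto simp: \<delta>_def decseq_def algebra_simps)
  have norm_g: "(norm (g n))\<^sup>2 \<le> (\<beta>\<^sub>0 n)\<^sup>2" for n
  proof -
    have "norm (g n) = \<beta>\<^sub>0 n * (norm (U (y n)) / max 1 (norm (U (y n))))"
      using \<beta>\<^sub>0[of n] by (simp add: g_def)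
    also have "\<dots> \<le> \<beta>\<^sub>0 n"
      using \<beta>\<^sub>0[of n] by (intro mult_left_le) auto
    finally show ?thesis by (simp add: power_mono)
  qed

  define A where "A p n = (norm (z n - p))\<^sup>2" for p n
  define V where "V p n = A p (Suc n) + \<delta> (Suc n) * A p n" for p n
  define e where "e n = \<xi> (Suc n) * (2 * (\<beta>\<^sub>0 (Suc n))\<^sup>2)" for n
  define s where "s p n = 2 * (\<xi> (Suc n) * (g (Suc n) \<bullet> (y (Suc n) - p)))
      + \<xi> (Suc n) * (norm (w (Suc n) - y (Suc n)))\<^sup>2 / 2" for p n
  have A0: "0 \<le> A p n" for p n by (simp add: A_def)
  have e0: "0 \<le> e n" for n using \<xi> by (simp add: e_def)
  have "summable (\<lambda>n. 2 * (\<xi> (Suc n) * (\<beta>\<^sub>0 (Suc n))\<^sup>2))"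
    using assms(14) by (intro summable_mult) (subst summable_Suc_iff)
  then have sum_e: "summable e"
    by (simp add: e_def[abs_def] mult.left_commute)
  have gy: "0 \<le> \<xi> (Suc n) * (g (Suc n) \<bullet> (y (Suc n) - p))" if "p \<in> vi_solutions U \<Omega>" for p n
    using vi_solution_inner_nonneg[OF mono that y_mem[of n]] \<xi> \<beta>\<^sub>0[of "Suc n"] by (simp add: g_def)
  have s0: "0 \<le> s p n" if "p \<in> vi_solutions U \<Omega>" for p n
    using gy[OF that, of n] \<xi>[of "Suc n"] by (simp add: s_def)
  have step: "V p (Suc n) \<le> V p n + e n - s p n" if "p \<in> vi_solutions U \<Omega>" for p n
  proof -
    define r where "r = 2 * (\<beta>\<^sub>0 (Suc n))\<^sup>2 - 2 * (g (Suc n) \<bullet> (y (Suc n) - p))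
        - (norm (w (Suc n) - y (Suc n)))\<^sup>2 / 2"
    have "p \<in> \<Omega>" using that by (simp add: vi_solutions_def)
    from closest_point_shifted_le[OF cvx cl this, of "y (Suc n)" "g (Suc n)"] norm_g[of "Suc n"]
    have "(norm (w (Suc n) - p))\<^sup>2 \<le> (norm (y (Suc n) - p))\<^sup>2 + r"
      by (simp add: r_def w_eq)
    then have "A p (Suc (Suc n)) \<le> (1 - \<delta> (Suc n)) * A p (Suc n) + \<delta> (Suc n) * A p n + \<xi> (Suc n) * r"
      unfolding A_def z_eq \<delta>_def using \<xi>[of "Suc n"] \<eta>[of "Suc n"] \<beta>\<^sub>1[of "Suc n"]
      by (intro relaxed_step_dist_le) (auto simp: y_def)
    moreover have "\<delta> (Suc (Suc n)) * A p (Suc n) \<le> \<delta> (Suc n) * A p (Suc n)"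
      using dec A0 by (intro mult_right_mono) (auto simp: decseq_Suc_iff)
    moreover have "\<xi> (Suc n) * r = e n - s p n"
      by (simp add: r_def e_def s_def algebra_simps)
    ultimately show ?thesis
      by (simp add: V_def algebra_simps)
  qed
  have V0: "0 \<le> V p n" for p n
    using A0 \<delta>0 by (simp add: V_def)
  note lyapunov = quasi_decreasing_convergent[OF V0 s0 e0 sum_e step]

  obtain p where p: "p \<in> vi_solutions U \<Omega>" using assms(7) by blast
  have "summable (\<lambda>n. \<xi> (Suc n) * (norm (w (Suc n) - y (Suc n)))\<^sup>2)"
  proof (rule summable_comparison_test'[where N = 0])
    show "summable (\<lambda>n. 2 * s p n)"
      using lyapunov(2)[OF p] p by (intro summable_mult) auto
    show "norm (\<xi> (Suc n) * (norm (w (Suc n) - y (Suc n)))\<^sup>2) \<le> 2 * s p n" for n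
      using gy[OF p, of n] \<xi>[of "Suc n"] by (simp add: s_def)
  qed
  then have sum_wy: "summable (\<lambda>n. (1 + 1 / Q\<^sub>1) * (\<xi> (Suc n) * (norm (w (Suc n) - y (Suc n)))\<^sup>2))"
    by (rule summable_mult)
  have "summable (\<lambda>n. (norm (z (Suc n) - z n))\<^sup>2)"
  proof (rule summable_contraction[OF _ _ sum_wy])
    show "(norm (z (Suc (Suc n)) - z (Suc n)))\<^sup>2 \<le> (1 - Q\<^sub>2) * (norm (z (Suc n) - z n))\<^sup>2
        + (1 + 1 / Q\<^sub>1) * (\<xi> (Suc n) * (norm (w (Suc n) - y (Suc n)))\<^sup>2)" for n
    proof -
      have "z (Suc (Suc n)) - z (Suc n)
          = \<xi> (Suc n) *\<^sub>R (w (Suc n) - z (Suc n)) - (\<beta>\<^sub>1 (Suc n) - 1) *\<^sub>R (z (Suc n) - z n)"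
        by (simp add: z_eq)
      moreover have "(\<beta>\<^sub>1 (Suc n) - 1 + \<xi> (Suc n))
          * (\<beta>\<^sub>1 (Suc n) - 1 + ((\<eta> (Suc n))\<^sup>2 + Q\<^sub>1) * \<xi> (Suc n)) * (norm (z (Suc n) - z n))\<^sup>2
          \<le> (1 - Q\<^sub>2) * (norm (z (Suc n) - z n))\<^sup>2"
        using Q(3) by (rule mult_right_mono) simp
      ultimately show ?thesis
        using relaxed_step_increment_le[of "\<beta>\<^sub>1 (Suc n) - 1" "\<xi> (Suc n)" "\<eta> (Suc n)" Q\<^sub>1
            "w (Suc n)" "z (Suc n)" "z n"] \<xi>[of "Suc n"] \<eta>[of "Suc n"] \<beta>\<^sub>1[of "Suc n"] Q(2)
        by (simp add: y_def)
    qed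
  qed (use Q \<xi> in auto)
  then have "(\<lambda>n. sqrt ((norm (z (Suc n) - z n))\<^sup>2)) \<longlonglongrightarrow> sqrt 0"
    by (intro tendsto_real_sqrt summable_LIMSEQ_zero)
  then have dz: "(\<lambda>n. norm (z (Suc n) - z n)) \<longlonglongrightarrow> 0"
    by simp

  have A_conv: "convergent (\<lambda>n. A q n)" if q: "q \<in> vi_solutions U \<Omega>" for q
  proof -
    obtain L where L: "V q \<longlonglongrightarrow> L"
      using lyapunov(1)[OF q] q by (auto simp: convergent_def)
    then obtain B where "\<And>n. \<bar>V q n\<bar> \<le> B"
      using convergent_imp_Bseq[of "V q"] by (auto simp: convergent_def Bseq_def)
    then have VB: "V q n \<le> B" for n
      using abs_le_D1 by blast
    have "B \<ge> 0" using VB[of 0] V0[of q 0] by linarith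
    have AB: "norm (z (Suc n) - q) \<le> sqrt B" for n
      using VB[of n] mult_nonneg_nonneg[OF \<delta>0[of "Suc n"] A0[of q n]]
      unfolding V_def A_def by (intro real_le_rsqrt) linarith
    have diff: "(\<lambda>n. A q (Suc (Suc n)) - A q (Suc n)) \<longlonglongrightarrow> 0"
    proof (rule Lim_null_comparison)
      show "\<forall>\<^sub>F n in sequentially. norm (A q (Suc (Suc n)) - A q (Suc n))
          \<le> 2 * sqrt B * norm (z (Suc (Suc n)) - z (Suc n))"
      proof (intro always_eventually allI)
        fix n
        define a b where "a = norm (z (Suc (Suc n)) - q)" and "b = norm (z (Suc n) - q)"
        have "\<bar>a - b\<bar> \<le> norm (z (Suc (Suc n)) - z (Suc n))"
          using norm_triangle_ineq3[of "z (Suc (Suc n)) - q" "z (Suc n) - q"] by (simp add: a_def b_def)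
        moreover have "\<bar>a + b\<bar> \<le> 2 * sqrt B"
          using AB[of n] AB[of "Suc n"] by (simp add: a_def b_def)
        ultimately have "\<bar>a + b\<bar> * \<bar>a - b\<bar> \<le> 2 * sqrt B * norm (z (Suc (Suc n)) - z (Suc n))"
          using \<open>B \<ge> 0\<close> by (intro mult_mono) auto
        moreover have "\<bar>a + b\<bar> * \<bar>a - b\<bar> = \<bar>a\<^sup>2 - b\<^sup>2\<bar>"
          by (simp add: algebra_simps power2_eq_square flip: abs_mult)
        ultimately show "norm (A q (Suc (Suc n)) - A q (Suc n))
            \<le> 2 * sqrt B * norm (z (Suc (Suc n)) - z (Suc n))"
          unfolding A_def a_def b_def real_norm_def by linarith
      qed
      show "(\<lambda>n. 2 * sqrt B * norm (z (Suc (Suc n)) - z (Suc n))) \<longlonglongrightarrow> 0"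
        using LIMSEQ_Suc[OF dz] by (rule tendsto_mult_right_zero)
    qed
    obtain d where d: "\<delta> \<longlonglongrightarrow> d"
      using decseq_convergent[OF dec] \<delta>0 by metis
    have "0 \<le> d"
      using d \<delta>0 by (auto intro: LIMSEQ_le_const)
    have "(\<lambda>n. (V q (Suc n) + \<delta> (Suc (Suc n)) * (A q (Suc (Suc n)) - A q (Suc n)))
        / (1 + \<delta> (Suc (Suc n)))) \<longlonglongrightarrow> (L + d * 0) / (1 + d)"
      using \<open>0 \<le> d\<close> by (intro tendsto_intros LIMSEQ_Suc L d diff) auto
    moreover have "(V q (Suc n) + \<delta> (Suc (Suc n)) * (A q (Suc (Suc n)) - A q (Suc n)))
        / (1 + \<delta> (Suc (Suc n))) = A q (Suc (Suc n))" for n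
      using \<delta>0[of "Suc (Suc n)"] by (simp add: V_def field_simps)
    ultimately have "(\<lambda>n. A q (Suc (Suc n))) \<longlonglongrightarrow> L / (1 + d)" by simp
    then show ?thesis
      using LIMSEQ_imp_Suc[of "\<lambda>n. A q (Suc n)"] LIMSEQ_imp_Suc[of "A q"] by (auto simp: convergent_def)
  qed

  obtain a where "A p \<longlonglongrightarrow> a" using A_conv[OF p] by (auto simp: convergent_def)
  then have "(\<lambda>n. sqrt (A p n)) \<longlonglongrightarrow> sqrt a" by (rule tendsto_real_sqrt)
  then have "Bseq (\<lambda>n. norm (z n - p))"
    by (intro convergent_imp_Bseq) (auto simp: A_def convergent_def)
  then obtain C where C: "\<And>n. norm (z n - p) \<le> C"
    by (auto simp: Bseq_def)
  have zy: "norm (y (Suc n) - z (Suc n)) \<le> norm (z (Suc n) - z n)" for n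
    using \<eta>[of "Suc n"] mult_right_mono[of "- \<eta> (Suc n)" 1 "norm (z (Suc n) - z n)"]
    by (simp add: y_def)
  have yzlim: "(\<lambda>n. y (Suc n) - z (Suc n)) \<longlonglongrightarrow> 0"
    by (rule Lim_null_comparison[OF always_eventually dz]) (simp add: zy)
  define K where "K = \<Omega> \<inter> cball p (3 * C)"
  have K: "compact K" unfolding K_def using cl by (simp add: closed_Int_compact)
  have yK: "y (Suc n) \<in> K" for n
  proof -
    have "norm (y (Suc n) - p) \<le> norm (y (Suc n) - z (Suc n)) + norm (z (Suc n) - p)"
      using norm_triangle_ineq[of "y (Suc n) - z (Suc n)" "z (Suc n) - p"] by simp
    moreover have "norm (z (Suc n) - z n) \<le> norm (z (Suc n) - p) + norm (z n - p)"
      using norm_triangle_ineq4[of "z (Suc n) - p" "z n - p"] by simp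
    ultimately have "norm (y (Suc n) - p) \<le> 3 * C"
      using zy[of n] C[of n] C[of "Suc n"] by linarith
    then show ?thesis
      using y_mem by (simp add: K_def dist_norm norm_minus_commute)
  qed
  have "compact (U ` K)"
    using K cont by (intro compact_continuous_image) (auto simp: K_def intro: continuous_on_subset)
  then obtain M where M: "\<And>x. x \<in> K \<Longrightarrow> norm (U x) \<le> M"
    using compact_imp_bounded bounded_iff by (metis imageI)

  define t where "t n = U (y (Suc n)) \<bullet> (y (Suc n) - p)" for n
  have t0: "0 \<le> t n" for n
    unfolding t_def by (rule vi_solution_inner_nonneg[OF mono p y_mem])
  have sum_t: "summable (\<lambda>n. \<xi> (Suc n) * \<beta>\<^sub>0 (Suc n) * t n)"
  proof (rule summable_comparison_test'[where N = 0])
    show "summable (\<lambda>n. max 1 M * s p n)"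
      using lyapunov(2)[OF p] p by (intro summable_mult) auto
    show "norm (\<xi> (Suc n) * \<beta>\<^sub>0 (Suc n) * t n) \<le> max 1 M * s p n" for n
    proof -
      define m where "m = max 1 (norm (U (y (Suc n))))"
      have m: "1 \<le> m" "m \<le> max 1 M"
        using M[OF yK[of n]] by (auto simp: m_def)
      have "\<xi> (Suc n) * \<beta>\<^sub>0 (Suc n) * t n = m * (\<xi> (Suc n) * (g (Suc n) \<bullet> (y (Suc n) - p)))"
        using m(1) by (simp add: g_def t_def flip: m_def)
      also have "\<dots> \<le> max 1 M * s p n"
        using m gy[OF p, of n] \<xi>[of "Suc n"] by (intro mult_mono) (auto simp: s_def)
      finally show ?thesis
        using \<xi>[of "Suc n"] \<beta>\<^sub>0[of "Suc n"] t0[of n] by simp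
    qed
  qed
  have "\<not> summable (\<lambda>n. \<xi> n * \<beta>\<^sub>0 n)"
    using assms(15) not_tendsto_and_filterlim_at_infinity[OF sequentially_bot summable_LIMSEQ]
      filterlim_at_top_imp_at_infinity by blast
  then have "\<not> summable (\<lambda>n. \<xi> (Suc n) * \<beta>\<^sub>0 (Suc n))"
    by (simp add: summable_Suc_iff[of "\<lambda>n. \<xi> n * \<beta>\<^sub>0 n"])
  then have "\<exists>n\<ge>N. t n < 1 / real (Suc N)" for N
    using \<xi> \<beta>\<^sub>0 sum_t by (intro summable_mult_nonsummable_imp_small[where c = "\<lambda>n. \<xi> (Suc n) * \<beta>\<^sub>0 (Suc n)"]) auto
  then obtain f where f: "\<And>N. f N \<ge> N" "\<And>N. t (f N) < 1 / real (Suc N)"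
    by metis
  obtain x k where x: "x \<in> K" "strict_mono k" "((\<lambda>n. y (Suc (f n))) \<circ> k) \<longlonglongrightarrow> x"
    using K yK unfolding compact_def by (metis (no_types, lifting))
  define h where "h n = f (k n)" for n
  have h: "filterlim h at_top sequentially"
  proof (rule filterlim_at_top_mono[OF filterlim_ident always_eventually], rule allI)
    show "n \<le> h n" for n
      using seq_suble[OF x(2), of n] f(1)[of "k n"] by (simp add: h_def)
  qed
  have yx: "(\<lambda>n. y (Suc (h n))) \<longlonglongrightarrow> x"
    using x(3) by (simp add: comp_def h_def)
  have "x \<in> \<Omega>" using x(1) by (simp add: K_def)
  have "(\<lambda>n. U (y (Suc (h n)))) \<longlonglongrightarrow> U x"
    using y_mem by (intro continuous_on_tendsto_compose[OF cont yx \<open>x \<in> \<Omega>\<close>]) auto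
  then have "(\<lambda>n. t (h n)) \<longlonglongrightarrow> U x \<bullet> (x - p)"
    unfolding t_def by (intro tendsto_intros yx)
  moreover have "(\<lambda>n. t (h n)) \<longlonglongrightarrow> 0"
  proof (rule Lim_null_comparison)
    show "\<forall>\<^sub>F n in sequentially. norm (t (h n)) \<le> 1 / real (Suc (k n))"
      using f(2) t0 by (auto simp: h_def intro!: always_eventually less_imp_le)
    show "(\<lambda>n. 1 / real (Suc (k n))) \<longlonglongrightarrow> 0"
      using LIMSEQ_subseq_LIMSEQ[OF LIMSEQ_Suc[OF lim_1_over_n] x(2)] by (simp add: comp_def)
  qed
  ultimately have "U x \<bullet> (x - p) = 0"
    by (rule LIMSEQ_unique)
  then have sol: "x \<in> vi_solutions U \<Omega>"
    using paramonotone_vi_solutionI[OF pm p \<open>x \<in> \<Omega>\<close>] by simp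

  have "(\<lambda>n. y (Suc (h n)) - (y (Suc (h n)) - z (Suc (h n)))) \<longlonglongrightarrow> x - 0"
    by (intro tendsto_diff yx filterlim_compose[OF yzlim h])
  then have "(\<lambda>n. (norm (z (Suc (h n)) - x))\<^sup>2) \<longlonglongrightarrow> (norm (x - x))\<^sup>2"
    by (intro tendsto_intros) simp
  then have Ah: "(\<lambda>n. A x (Suc (h n))) \<longlonglongrightarrow> 0"
    by (simp add: A_def)
  obtain l where l: "A x \<longlonglongrightarrow> l"
    using A_conv[OF sol] by (auto simp: convergent_def)
  have "l = 0"
    using LIMSEQ_unique[OF filterlim_compose[OF LIMSEQ_Suc[OF l] h] Ah] .
  with l have "(\<lambda>n. sqrt (A x n)) \<longlonglongrightarrow> sqrt 0"
    by (intro tendsto_real_sqrt) simp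
  then have "z \<longlonglongrightarrow> x"
    by (simp add: A_def tendsto_norm_zero_iff LIM_zero_iff)
  with sol show ?thesis by blast
qed

end
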